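(* Let $X$ be an arbitrary bounded metric space, let $\lambda>0$ be a real number, and let $\lambda\Delta$ be a simplex all of whose non-zero distances equal $\lambda$, of cardinality $m=\#\lambda\Delta\le\#X$. Suppose that $2d_m^+(X)\le\operatorname{diam}X-\alpha_m(X)$. Then $$2d_{GH}(\lambda\Delta,X)=\max\{\operatorname{diam}X-\lambda,\ \lambda-\alpha_m(X)\}.$$
   Context: Metric spaces are assumed non-empty. $\#X$ denotes the cardinality of $X$; $|xy|$ denotes the distance between points $x,y$. A simplex is a metric space all of whose non-zero distances are equal; $\lambda\Delta$ denotes a simplex whose non-zero distances all equal $\lambda>0$ (its cardinality may be any finite or infinite non-zero cardinal). For metric spaces $X,Y$, the Gromov--Hausdorff distance $d_{GH}(X,Y)$ is the infimum of real numbers $r$ for which there exist a metric space $Z$ and subsets $X',Y'\subset Z$ isometric to $X$ and $Y$, respectively, such that $d_H(X',Y')\le r$, where $d_H$ is the Hausdorff distance in $Z$. For a cardinal number $m\le\#X$ let $\mathcal{D}_m(X)$ be the set of all partitions of $X$ into $m$ non-empty subsets. For $D=\{X_i\}_{i\in I}\in\mathcal{D}_m(X)$ put $\operatorname{diam}D=\sup_{i\in I}\operatorname{diam}X_i$ and $\alpha(D)=\inf\{|X_iX_j| : i\ne j\}$, where $|AB|=\inf\{|ab| : a\in A,\ b\in B\}$ for non-empty $A,B\subset X$; for $m=1$ the infimum over the empty set is $\alpha(D)=+\infty$, and expressions are read in the extended reals. Put $$\alpha_m(X)=\sup_{D\in\mathcal{D}_m(X)}\alpha(D),\qquad d_m^+(X)=\sup_{D\in\mathcal{D}_m(X)}\operatorname{diam}D.$$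 *)

theory Defs
  imports "HOL-Analysis.Analysis" "HOL-Library.Disjoint_Sets"
begin

unbundle cardinal_syntax

text \<open>
  Metric spaces are elements of the library type \<open>'a metric\<close>. That type also contains the empty
  space, so non-emptiness has to be assumed separately.
  All suprema and infima of distances are taken in the extended reals.
\<close>

definition metric_simplex :: "real \<Rightarrow> 'a metric \<Rightarrow> bool" where
  "metric_simplex l S \<longleftrightarrow>
     (\<forall>x\<in>mspace S. \<forall>y\<in>mspace S. mdist S x y \<noteq> 0 \<longrightarrow> mdist S x y = l)"

definition isometric_metrics :: "'a metric \<Rightarrow> 'b metric \<Rightarrow> bool" where
  "isometric_metrics X Y \<longleftrightarrow>
     (\<exists>f. bij_betw f (mspace X) (mspace Y) \<and>
          (\<forall>x\<in>mspace X. \<forall>y\<in>mspace X. mdist Y (f x) (f y) = mdist X x y))"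

definition hausdorff_dist :: "'a metric \<Rightarrow> 'a set \<Rightarrow> 'a set \<Rightarrow> ereal" where
  "hausdorff_dist Z A B =
     max (SUP a\<in>A. INF b\<in>B. ereal (mdist Z a b)) (SUP b\<in>B. INF a\<in>A. ereal (mdist Z a b))"

text \<open>
  HOL cannot quantify over all types, so the ambient space \<open>Z\<close> has its points in \<open>'a + 'b\<close>.
  Only the subspace \<open>X' \<union> Y'\<close> of \<open>Z\<close> matters, and it always embeds into \<open>'a + 'b\<close>;
  \<open>gh_dist_le\<close> below shows that ambient spaces over any other type cannot lower the value.
\<close>

definition gh_dist :: "'a metric \<Rightarrow> 'b metric \<Rightarrow> ereal" where
  "gh_dist X Y =
     (INF r \<in> {r :: real. \<exists>(Z :: ('a + 'b) metric) X' Y'.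
                 X' \<subseteq> mspace Z \<and> Y' \<subseteq> mspace Z \<and>
                 isometric_metrics X (submetric Z X') \<and> isometric_metrics Y (submetric Z Y') \<and>
                 hausdorff_dist Z X' Y' \<le> ereal r}. ereal r)"

definition set_diam :: "'a metric \<Rightarrow> 'a set \<Rightarrow> ereal" where
  "set_diam X A = (SUP x\<in>A. SUP y\<in>A. ereal (mdist X x y))"

definition set_dist :: "'a metric \<Rightarrow> 'a set \<Rightarrow> 'a set \<Rightarrow> ereal" where
  "set_dist X A B = (INF a\<in>A. INF b\<in>B. ereal (mdist X a b))"

text \<open>
  Cardinal numbers are rendered by the library's cardinal orders; \<open>m\<close> is meant to be \<open>|K|\<close> for
  some set \<open>K\<close>.
\<close>

definition card_partitions :: "'c rel \<Rightarrow> 'a metric \<Rightarrow> 'a set set set" where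
  "card_partitions m X = {D. partition_on (mspace X) D \<and> |D| =o m}"

definition part_diam :: "'a metric \<Rightarrow> 'a set set \<Rightarrow> ereal" where
  "part_diam X D = (SUP A\<in>D. set_diam X A)"

text \<open>For a partition with a single block the infimum is over the empty set, hence \<open>\<infinity>\<close>.\<close>

definition part_alpha :: "'a metric \<Rightarrow> 'a set set \<Rightarrow> ereal" where
  "part_alpha X D = Inf {set_dist X A B | A B. A \<in> D \<and> B \<in> D \<and> A \<noteq> B}"

definition alpha :: "'c rel \<Rightarrow> 'a metric \<Rightarrow> ereal" where
  "alpha m X = (SUP D \<in> card_partitions m X. part_alpha X D)"

definition d_plus :: "'c rel \<Rightarrow> 'a metric \<Rightarrow> ereal" where
  "d_plus m X = (SUP D \<in> card_partitions m X. part_diam X D)"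

lemma gh_dist_le:
  fixes X :: "'a metric" and Y :: "'b metric" and Z :: "'c metric"
  assumes sub: "X' \<subseteq> mspace Z" "Y' \<subseteq> mspace Z"
    and isoX: "isometric_metrics X (submetric Z X')"
    and isoY: "isometric_metrics Y (submetric Z Y')"
    and le: "hausdorff_dist Z X' Y' \<le> ereal r"
  shows "gh_dist X Y \<le> ereal r"
proof -
  obtain f where f: "bij_betw f (mspace X) X'"
    "\<And>x y. x \<in> mspace X \<Longrightarrow> y \<in> mspace X \<Longrightarrow> mdist Z (f x) (f y) = mdist X x y"
    using isoX sub(1) unfolding isometric_metrics_def by (auto simp: Int_absorb2)
  obtain g where g: "bij_betw g (mspace Y) Y'"
    "\<And>x y. x \<in> mspace Y \<Longrightarrow> y \<in> mspace Y \<Longrightarrow> mdist Z (g x) (g y) = mdist Y x y"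
    using isoY sub(2) unfolding isometric_metrics_def by (auto simp: Int_absorb2)
  define h :: "'c \<Rightarrow> 'a + 'b" where
    "h z = (if z \<in> X' then Inl (inv_into (mspace X) f z) else Inr (inv_into (mspace Y) g z))" for z
  define U where "U = X' \<union> Y'"
  define k where "k = inv_into U h"
  have injf: "inj_on (inv_into (mspace X) f) X'" and injg: "inj_on (inv_into (mspace Y) g) Y'"
    using f(1) g(1) by (auto simp: bij_betw_def intro: inj_on_inv_into)
  have inj: "inj_on h U"
    using injf injg unfolding inj_on_def h_def U_def by (auto split: if_splits)
  have kh: "k (h z) = z" if "z \<in> U" for z
    using inj that by (simp add: k_def)
  have Usub: "U \<subseteq> mspace Z" using sub by (auto simp: U_def)
  have "Metric_space (h ` U) (\<lambda>u v. mdist Z (k u) (k v))"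
  proof
    show "mdist Z (k u) (k v) = mdist Z (k v) (k u)" for u v
      by (rule mdist_commute)
    show "(mdist Z (k u) (k v) = 0) = (u = v)" if "u \<in> h ` U" "v \<in> h ` U" for u v
      using that Usub kh by (auto simp: subset_iff)
    show "mdist Z (k u) (k w) \<le> mdist Z (k u) (k v) + mdist Z (k v) (k w)"
      if "u \<in> h ` U" "v \<in> h ` U" "w \<in> h ` U" for u v w
      using that Usub kh by (auto simp: subset_iff intro!: mdist_triangle)
  qed auto
  then obtain W where W: "mspace W = h ` U" "mdist W = (\<lambda>u v. mdist Z (k u) (k v))"
    by (metis Metric_space.mspace_metric Metric_space.mdist_metric)
  have dW: "mdist W (h a) (h b) = mdist Z a b" if "a \<in> U" "b \<in> U" for a b
    using that by (simp add: W kh)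
  have XU: "X' \<subseteq> U" and YU: "Y' \<subseteq> U" by (auto simp: U_def)
  have "bij_betw h X' (h ` X')" "bij_betw h Y' (h ` Y')"
    using inj XU YU by (auto intro: inj_on_imp_bij_betw inj_on_subset)
  with f(1) g(1) have bX: "bij_betw (h \<circ> f) (mspace X) (h ` X')"
    and bY: "bij_betw (h \<circ> g) (mspace Y) (h ` Y')"
    by (blast intro: bij_betw_trans)+
  have sW: "h ` X' \<subseteq> mspace W" "h ` Y' \<subseteq> mspace W"
    using XU YU by (auto simp: W)
  have fU: "f x \<in> U" if "x \<in> mspace X" for x
    using f(1) that XU by (auto simp: bij_betw_def)
  have gU: "g x \<in> U" if "x \<in> mspace Y" for x
    using g(1) that YU by (auto simp: bij_betw_def)
  have "isometric_metrics X (submetric W (h ` X'))"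
    unfolding isometric_metrics_def
    using bX sW by (intro exI[of _ "h \<circ> f"]) (auto simp: Int_absorb2 dW fU f(2))
  moreover have "isometric_metrics Y (submetric W (h ` Y'))"
    unfolding isometric_metrics_def
    using bY sW by (intro exI[of _ "h \<circ> g"]) (auto simp: Int_absorb2 dW gU g(2))
  moreover have "hausdorff_dist W (h ` X') (h ` Y') = hausdorff_dist Z X' Y'"
  proof -
    have "mdist W (h a) (h b) = mdist Z a b" if "a \<in> X'" "b \<in> Y'" for a b
      using that dW XU YU by blast
    then have "(SUP a\<in>X'. INF b\<in>Y'. ereal (mdist W (h a) (h b))) =
                 (SUP a\<in>X'. INF b\<in>Y'. ereal (mdist Z a b))"
      and "(SUP b\<in>Y'. INF a\<in>X'. ereal (mdist W (h a) (h b))) =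
             (SUP b\<in>Y'. INF a\<in>X'. ereal (mdist Z a b))"
      by (auto intro!: SUP_cong INF_cong)
    then show ?thesis
      unfolding hausdorff_dist_def by (simp only: image_image)
  qed
  ultimately show ?thesis
    unfolding gh_dist_def using sW le
    by (intro INF_lower CollectI exI[of _ W] exI[of _ "h ` X'"] exI[of _ "h ` Y'"]) simp
qed

end

theory Submission
  imports Defs
begin

text \<open>
  Up to a factor of two, the Gromov--Hausdorff distance is the least distortion of a
  correspondence between the two spaces, and a correspondence with a simplex of distance \<open>l\<close> is
  almost the same thing as a partition of \<open>X\<close> into \<open>m\<close> blocks.

  Lower bound. If \<open>gh_dist S X < t\<close>, matching points at distance below \<open>t\<close> in an ambient space
  gives a correspondence of distortion below \<open>2 * t\<close> (\<open>gh_dist_less_imp_correspondence\<close>). Since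
  distances in \<open>S\<close> are at most \<open>l\<close>, those in \<open>X\<close> are at most \<open>l + 2 * t\<close>, so
  \<open>2 * t \<ge> diam X - l\<close>. If \<open>2 * t \<le> l\<close>, no point of \<open>X\<close> corresponds to two points of \<open>S\<close>, so the
  correspondence is the graph of a surjection \<open>X \<rightarrow> S\<close>; its fibres form a partition into \<open>m\<close>
  blocks at mutual distance at least \<open>l - 2 * t\<close>, so \<open>2 * t \<ge> l - alpha m X\<close>. If \<open>2 * t > l\<close>, the
  latter is trivial.

  Upper bound. Sending each block of a partition \<open>D\<close> to its own point of \<open>S\<close> is a surjection of
  distortion at most the maximum of \<open>diam D\<close>, \<open>diam X - l\<close> and \<open>l - \<alpha>(D)\<close>, and a surjection of
  distortion at most \<open>2 * r\<close> lets one glue the two spaces at distance \<open>r\<close>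
  (\<open>gh_dist_le_of_surjection\<close>). Optimising over \<open>D\<close> replaces \<open>\<alpha>(D)\<close> by \<open>alpha m X\<close>, and the term
  \<open>diam D\<close> disappears: the numbers \<open>diam X - l\<close> and \<open>l - alpha m X\<close> have sum
  \<open>diam X - alpha m X\<close>, which by hypothesis is at least \<open>2 * d_plus m X\<close>, so the larger of them is
  at least \<open>d_plus m X\<close>.

  A one-point simplex has \<open>alpha m X = \<infinity>\<close>; for bounded \<open>X\<close> this contradicts the hypothesis on
  \<open>d_plus m X\<close>.
\<close>

section \<open>Partitions as fibres of surjections\<close>

definition fibres :: "('a \<Rightarrow> 'b) \<Rightarrow> 'a set \<Rightarrow> 'a set set" where
  "fibres g A = (\<lambda>i. {x \<in> A. g x = i}) ` g ` A"

lemma fibres_partition_on: "partition_on A (fibres g A)"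
  by (auto simp: partition_on_def fibres_def disjoint_def)

lemma card_of_fibres: "|fibres g A| =o |g ` A|"
proof -
  have "inj_on (\<lambda>i. {x \<in> A. g x = i}) (g ` A)"
    by (rule inj_onI) auto
  then have "bij_betw (\<lambda>i. {x \<in> A. g x = i}) (g ` A) (fibres g A)"
    by (simp add: fibres_def inj_on_imp_bij_betw)
  then show ?thesis
    using card_of_ordIsoI ordIso_symmetric by blast
qed

text \<open>
  Indexing the blocks by \<open>K\<close> and sending each point to the index of its block turns a partition
  into a surjection. All later estimates are made for surjections, where two points lie in the
  same block iff they have the same image.
\<close>

lemma card_partitions_eq_fibres:
  "card_partitions |K| X = {fibres g (mspace X) | g. g ` mspace X = K}"
proof (intro equalityI subsetI)
  fix D assume "D \<in> card_partitions |K| X"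
  then have part: "partition_on (mspace X) D" and "|D| =o |K|"
    by (auto simp: card_partitions_def)
  then obtain b where b: "bij_betw b D K"
    using card_of_ordIso by blast
  define blk where "blk x = (THE A. A \<in> D \<and> x \<in> A)" for x
  have blk: "blk x = A" if "A \<in> D" "x \<in> A" for x A
    unfolding blk_def using that part
    by (intro the_equality) (auto simp: partition_on_def disjoint_def)
  have sub: "A \<subseteq> mspace X" and ne: "A \<noteq> {}" if "A \<in> D" for A
    using that part by (auto simp: partition_on_def)
  have ex: "\<exists>A\<in>D. x \<in> A" if "x \<in> mspace X" for x
    using that part by (auto simp: partition_on_def)
  have blk_image: "blk ` mspace X = D"
  proof (intro equalityI subsetI)
    fix A assume "A \<in> blk ` mspace X"
    then obtain x where x: "x \<in> mspace X" "A = blk x"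
      by blast
    then obtain B where "B \<in> D" "x \<in> B"
      using ex by blast
    then show "A \<in> D"
      using blk x(2) by simp
  next
    fix A assume A: "A \<in> D"
    then obtain x where x: "x \<in> A"
      using ne by blast
    then show "A \<in> blk ` mspace X"
      using blk[OF A x] sub[OF A] by blast
  qed
  have surj: "(b \<circ> blk) ` mspace X = K"
    using b by (metis blk_image bij_betw_imp_surj_on image_comp)
  have block: "{x \<in> mspace X. (b \<circ> blk) x = b A} = A" if "A \<in> D" for A
  proof -
    have "b (blk x) = b A \<longleftrightarrow> x \<in> A" if "x \<in> mspace X" for x
    proof -
      obtain B where "B \<in> D" "x \<in> B"
        using ex \<open>x \<in> mspace X\<close> by blast
      then show ?thesis
        using b \<open>A \<in> D\<close> blk by (metis bij_betw_def inj_on_eq_iff)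
    qed
    then show ?thesis
      using sub[OF that] by auto
  qed
  have "fibres (b \<circ> blk) (mspace X) = (\<lambda>A. {x \<in> mspace X. (b \<circ> blk) x = b A}) ` D"
    unfolding fibres_def surj using bij_betw_imp_surj_on[OF b] by (metis image_image)
  also have "\<dots> = D"
    using block by simp
  finally show "D \<in> {fibres g (mspace X) | g. g ` mspace X = K}"
    using surj by blast
next
  fix D assume "D \<in> {fibres g (mspace X) | g. g ` mspace X = K}"
  then show "D \<in> card_partitions |K| X"
    using fibres_partition_on card_of_fibres by (auto simp: card_partitions_def)
qed

lemma le_part_alpha_fibres_iff:
  "c \<le> part_alpha X (fibres g (mspace X)) \<longleftrightarrow>
     (\<forall>x\<in>mspace X. \<forall>y\<in>mspace X. g x \<noteq> g y \<longrightarrow> c \<le> ereal (mdist X x y))"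
proof
  assume L: "c \<le> part_alpha X (fibres g (mspace X))"
  show "\<forall>x\<in>mspace X. \<forall>y\<in>mspace X. g x \<noteq> g y \<longrightarrow> c \<le> ereal (mdist X x y)"
  proof (intro ballI impI)
    fix x y assume xy: "x \<in> mspace X" "y \<in> mspace X" "g x \<noteq> g y"
    define A where "A = {z \<in> mspace X. g z = g x}"
    define B where "B = {z \<in> mspace X. g z = g y}"
    have "A \<in> fibres g (mspace X)" "B \<in> fibres g (mspace X)" "x \<in> A" "y \<in> B" "A \<noteq> B"
      using xy by (auto simp: fibres_def A_def B_def)
    then have "part_alpha X (fibres g (mspace X)) \<le> set_dist X A B"
      unfolding part_alpha_def by (intro Inf_lower) blast
    also have "\<dots> \<le> ereal (mdist X x y)"
      unfolding set_dist_def using \<open>x \<in> A\<close> \<open>y \<in> B\<close> by (meson INF_lower INF_lower2)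
    finally show "c \<le> ereal (mdist X x y)"
      using L by simp
  qed
next
  assume R: "\<forall>x\<in>mspace X. \<forall>y\<in>mspace X. g x \<noteq> g y \<longrightarrow> c \<le> ereal (mdist X x y)"
  show "c \<le> part_alpha X (fibres g (mspace X))"
    unfolding part_alpha_def
  proof (rule Inf_greatest)
    fix d assume "d \<in> {set_dist X A B |A B. A \<in> fibres g (mspace X) \<and> B \<in> fibres g (mspace X) \<and> A \<noteq> B}"
    then obtain A B where d: "d = set_dist X A B"
      and A: "A \<in> fibres g (mspace X)" and B: "B \<in> fibres g (mspace X)" and "A \<noteq> B"
      by blast
    from A obtain i where i: "A = {z \<in> mspace X. g z = i}"
      unfolding fibres_def by (rule imageE)
    from B obtain j where j: "B = {z \<in> mspace X. g z = j}"
      unfolding fibres_def by (rule imageE)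
    have "i \<noteq> j"
      using \<open>A \<noteq> B\<close> i j by blast
    then have "c \<le> ereal (mdist X x y)" if "x \<in> A" "y \<in> B" for x y
      using R that unfolding i j by simp
    then show "c \<le> d"
      unfolding d set_dist_def by (intro INF_greatest)
  qed
qed

lemma mdist_le_part_diam_fibres:
  assumes "x \<in> mspace X" "y \<in> mspace X" "g x = g y"
  shows "ereal (mdist X x y) \<le> part_diam X (fibres g (mspace X))"
proof -
  define A where "A = {z \<in> mspace X. g z = g x}"
  have "A \<in> fibres g (mspace X)" "x \<in> A" "y \<in> A"
    using assms by (auto simp: A_def fibres_def)
  then show ?thesis
    unfolding part_diam_def set_diam_def by (meson SUP_upper SUP_upper2)
qed

lemma mdist_le_set_diam:
  "x \<in> A \<Longrightarrow> y \<in> A \<Longrightarrow> ereal (mdist X x y) \<le> set_diam X A"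
  unfolding set_diam_def by (meson SUP_upper SUP_upper2)

lemma card_partitions_nonempty:
  fixes K :: "'b set"
  assumes "K \<noteq> {}" "|K| \<le>o |mspace X|"
  shows "card_partitions |K| X \<noteq> {}"
proof -
  obtain g where "g ` mspace X = K"
    using assms card_of_ordLeq2 by metis
  then show ?thesis
    by (auto simp: card_partitions_eq_fibres)
qed

lemma alpha_nonneg:
  fixes K :: "'b set"
  assumes "K \<noteq> {}" "|K| \<le>o |mspace X|"
  shows "0 \<le> alpha |K| X"
proof -
  obtain D where D: "D \<in> card_partitions |K| X"
    using card_partitions_nonempty[OF assms] by blast
  then have "0 \<le> part_alpha X D"
    by (auto simp: card_partitions_eq_fibres le_part_alpha_fibres_iff)
  also have "\<dots> \<le> alpha |K| X"
    unfolding alpha_def using D by (rule SUP_upper)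
  finally show ?thesis .
qed

lemma part_diam_nonneg:
  fixes K :: "'b set" and X :: "'a metric"
  assumes "D \<in> card_partitions |K| X" "mspace X \<noteq> {}"
  shows "0 \<le> part_diam X D"
proof -
  have "D \<in> {fibres g (mspace X) | g. g ` mspace X = K}"
    using assms(1) unfolding card_partitions_eq_fibres .
  then obtain g :: "'a \<Rightarrow> 'b" where D: "D = fibres g (mspace X)"
    by blast
  obtain x where x: "x \<in> mspace X"
    using assms(2) by blast
  have "0 \<le> ereal (mdist X x x)"
    by simp
  also have "\<dots> \<le> part_diam X D"
    unfolding D using x by (intro mdist_le_part_diam_fibres refl)
  finally show ?thesis .
qed

section \<open>Gromov--Hausdorff distance and distortion\<close>

text \<open>
  The relation consists of the pairs of points at distance less than \<open>t\<close> in an ambient space; its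
  distortion is estimated by the triangle inequality there.
\<close>

lemma gh_dist_less_imp_correspondence:
  fixes S :: "'b metric" and X :: "'a metric"
  assumes "gh_dist S X < ereal t"
  obtains R where
    "\<And>i. i \<in> mspace S \<Longrightarrow> \<exists>x\<in>mspace X. R i x"
    "\<And>x. x \<in> mspace X \<Longrightarrow> \<exists>i\<in>mspace S. R i x"
    "\<And>i j x y. \<lbrakk>i \<in> mspace S; j \<in> mspace S; x \<in> mspace X; y \<in> mspace X; R i x; R j y\<rbrakk>
       \<Longrightarrow> \<bar>mdist S i j - mdist X x y\<bar> < 2 * t"
proof -
  obtain r :: real and Z :: "('b + 'a) metric" and S' X'
    where sub: "S' \<subseteq> mspace Z" "X' \<subseteq> mspace Z"
      and iso: "isometric_metrics S (submetric Z S')" "isometric_metrics X (submetric Z X')"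
      and hd: "hausdorff_dist Z S' X' \<le> ereal r" and rt: "r < t"
    using assms unfolding gh_dist_def INF_less_iff by auto
  obtain f where f: "f ` mspace S = S'"
    "\<And>x y. x \<in> mspace S \<Longrightarrow> y \<in> mspace S \<Longrightarrow> mdist Z (f x) (f y) = mdist S x y"
    using iso(1) sub(1) unfolding isometric_metrics_def bij_betw_def by (auto simp: Int_absorb1 Int_absorb2)
  obtain g where g: "g ` mspace X = X'"
    "\<And>x y. x \<in> mspace X \<Longrightarrow> y \<in> mspace X \<Longrightarrow> mdist Z (g x) (g y) = mdist X x y"
    using iso(2) sub(2) unfolding isometric_metrics_def bij_betw_def by (auto simp: Int_absorb1 Int_absorb2)
  have hdt: "hausdorff_dist Z S' X' < ereal t"
    using hd rt by (meson ereal_less(2) le_less_trans less_ereal.simps(1))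
  have near: "\<exists>x\<in>mspace X. mdist Z (f i) (g x) < t" if "i \<in> mspace S" for i
  proof -
    have "(INF b\<in>X'. ereal (mdist Z (f i) b)) \<le> hausdorff_dist Z S' X'"
      unfolding hausdorff_dist_def using that f(1) by (intro max.coboundedI1 SUP_upper) auto
    then have "(INF b\<in>X'. ereal (mdist Z (f i) b)) < ereal t"
      using hdt by simp
    then show ?thesis
      unfolding INF_less_iff using g(1) by auto
  qed
  have near': "\<exists>i\<in>mspace S. mdist Z (f i) (g x) < t" if "x \<in> mspace X" for x
  proof -
    have "(INF a\<in>S'. ereal (mdist Z a (g x))) \<le> hausdorff_dist Z S' X'"
      unfolding hausdorff_dist_def using that g(1) by (intro max.coboundedI2 SUP_upper) auto
    then have "(INF a\<in>S'. ereal (mdist Z a (g x))) < ereal t"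
      using hdt by simp
    then show ?thesis
      unfolding INF_less_iff using f(1) by auto
  qed
  show ?thesis
  proof (rule that[of "\<lambda>i x. mdist Z (f i) (g x) < t"])
    fix i j x y
    assume "i \<in> mspace S" "j \<in> mspace S" "x \<in> mspace X" "y \<in> mspace X"
      and close: "mdist Z (f i) (g x) < t" "mdist Z (f j) (g y) < t"
    then have Z: "f i \<in> mspace Z" "f j \<in> mspace Z" "g x \<in> mspace Z" "g y \<in> mspace Z"
      and d: "mdist S i j = mdist Z (f i) (f j)" "mdist X x y = mdist Z (g x) (g y)"
      using f g sub by auto
    have "mdist Z (f i) (f j) \<le> mdist Z (f i) (g x) + mdist Z (g x) (g y) + mdist Z (f j) (g y)"
      using mdist_triangle[OF Z(1,3,2)] mdist_triangle[OF Z(3,4,2)] mdist_commute[of Z "f j" "g y"]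
      by linarith
    moreover have "mdist Z (g x) (g y) \<le> mdist Z (f i) (g x) + mdist Z (f i) (f j) + mdist Z (f j) (g y)"
      using mdist_triangle[OF Z(3,1,4)] mdist_triangle[OF Z(1,2,4)] mdist_commute[of Z "f i" "g x"]
      by linarith
    ultimately show "\<bar>mdist S i j - mdist X x y\<bar> < 2 * t"
      using close d by linarith
  qed (use near near' in auto)
qed

text \<open>
  The ambient space is the disjoint union of \<open>S\<close> and \<open>X\<close> with a bridge of length \<open>r\<close> from each \<open>x\<close> to
  \<open>f x\<close>: a path from \<open>i\<close> to \<open>x\<close> crosses the bridge at some \<open>u\<close>, which gives
  \<open>r + (INF u. d(i, f u) + d(u, x))\<close>. The distortion bound says exactly that crossing two bridges is
  no shortcut inside \<open>S\<close> or inside \<open>X\<close>; positivity of \<open>r\<close> keeps the two copies disjoint.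
\<close>

lemma gh_dist_le_of_surjection:
  fixes S :: "'b metric" and X :: "'a metric"
  assumes f: "f ` mspace X = mspace S" and ne: "mspace X \<noteq> {}" and r: "0 < r"
    and dis: "\<And>x y. x \<in> mspace X \<Longrightarrow> y \<in> mspace X \<Longrightarrow> \<bar>mdist S (f x) (f y) - mdist X x y\<bar> \<le> 2 * r"
  shows "gh_dist S X \<le> ereal r"
proof -
  define E where "E i x = (INF u\<in>mspace X. mdist S i (f u) + mdist X u x)" for i x
  have bdd: "bdd_below ((\<lambda>u. mdist S i (f u) + mdist X u x) ` mspace X)" for i x
    by (intro bdd_belowI2[of _ 0]) simp
  have E_le: "E i x \<le> mdist S i (f u) + mdist X u x" if "u \<in> mspace X" for i x u
    unfolding E_def by (rule cINF_lower[OF bdd that])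
  have le_E: "c \<le> E i x" if "\<And>u. u \<in> mspace X \<Longrightarrow> c \<le> mdist S i (f u) + mdist X u x" for c i x
    unfolding E_def using ne that by (intro cINF_greatest) auto
  have E_nonneg: "0 \<le> E i x" for i x
    by (rule le_E) simp
  have fS: "f u \<in> mspace S" if "u \<in> mspace X" for u
    using f that by blast
  have E_S: "E i x \<le> mdist S i j + E j x" if ij: "i \<in> mspace S" "j \<in> mspace S" for i j x
  proof -
    have "E i x - mdist S i j \<le> E j x"
    proof (rule le_E)
      fix u assume "u \<in> mspace X"
      then show "E i x - mdist S i j \<le> mdist S j (f u) + mdist X u x"
        using E_le[of u i x] mdist_triangle[OF ij fS[of u]] by linarith
    qed
    then show ?thesis by simp
  qed
  have E_X: "E i y \<le> E i x + mdist X x y" if xy: "x \<in> mspace X" "y \<in> mspace X" for i x y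
  proof -
    have "E i y - mdist X x y \<le> E i x"
    proof (rule le_E)
      fix u assume u: "u \<in> mspace X"
      then show "E i y - mdist X x y \<le> mdist S i (f u) + mdist X u x"
        using E_le[OF u, of i y] mdist_triangle[OF u xy] by linarith
    qed
    then show ?thesis by simp
  qed
  have S_E: "mdist S i j \<le> E i x + E j x + 2 * r"
    if i: "i \<in> mspace S" and j: "j \<in> mspace S" and x: "x \<in> mspace X" for i j x
  proof -
    have "mdist S i j - E j x - 2 * r \<le> E i x"
    proof (rule le_E)
      fix u assume u: "u \<in> mspace X"
      have "mdist S i j - 2 * r - (mdist S i (f u) + mdist X u x) \<le> E j x"
      proof (rule le_E)
        fix v assume v: "v \<in> mspace X"
        show "mdist S i j - 2 * r - (mdist S i (f u) + mdist X u x) \<le> mdist S j (f v) + mdist X v x"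
          using mdist_triangle[OF i fS[OF u] j] mdist_triangle[OF fS[OF u] fS[OF v] j]
            mdist_triangle[OF u x v] dis[OF u v]
            mdist_commute[of S "f v" j] mdist_commute[of X x v] by linarith
      qed
      then show "mdist S i j - E j x - 2 * r \<le> mdist S i (f u) + mdist X u x" by simp
    qed
    then show ?thesis by simp
  qed
  have X_E: "mdist X x y \<le> E i x + E i y + 2 * r"
    if i: "i \<in> mspace S" and x: "x \<in> mspace X" and y: "y \<in> mspace X" for i x y
  proof -
    have "mdist X x y - E i y - 2 * r \<le> E i x"
    proof (rule le_E)
      fix u assume u: "u \<in> mspace X"
      have "mdist X x y - 2 * r - (mdist S i (f u) + mdist X u x) \<le> E i y"
      proof (rule le_E)
        fix v assume v: "v \<in> mspace X"
        show "mdist X x y - 2 * r - (mdist S i (f u) + mdist X u x) \<le> mdist S i (f v) + mdist X v y"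
          using mdist_triangle[OF x u y] mdist_triangle[OF u v y]
            mdist_triangle[OF fS[OF u] i fS[OF v]] dis[OF u v]
            mdist_commute[of S "f u" i] mdist_commute[of X x u] by linarith
      qed
      then show "mdist X x y - E i y - 2 * r \<le> mdist S i (f u) + mdist X u x" by simp
    qed
    then show ?thesis by simp
  qed
  define M :: "('b + 'a) set" where "M = Inl ` mspace S \<union> Inr ` mspace X"
  define d :: "'b + 'a \<Rightarrow> 'b + 'a \<Rightarrow> real" where
    "d p q = (case p of
        Inl i \<Rightarrow> (case q of Inl j \<Rightarrow> mdist S i j | Inr y \<Rightarrow> r + E i y)
      | Inr x \<Rightarrow> (case q of Inl j \<Rightarrow> r + E j x | Inr y \<Rightarrow> mdist X x y))" for p q
  have rE: "0 < r + E i x" for i x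
    using r E_nonneg[of i x] by linarith
  have d_simps [simp]: "d (Inl i) (Inl j) = mdist S i j" "d (Inl i) (Inr y) = r + E i y"
    "d (Inr x) (Inl j) = r + E j x" "d (Inr x) (Inr y) = mdist X x y" for i j x y
    by (simp_all add: d_def)
  have mem_M: "Inl i \<in> M \<longleftrightarrow> i \<in> mspace S" "Inr x \<in> M \<longleftrightarrow> x \<in> mspace X" for i x
    by (auto simp: M_def)
  have "Metric_space M d"
  proof
    show "0 \<le> d p q" for p q
      using rE by (cases p; cases q) (simp_all add: less_imp_le)
    show "d p q = d q p" for p q
      by (cases p; cases q) (simp_all add: mdist_commute)
    show "(d p q = 0) = (p = q)" if "p \<in> M" "q \<in> M" for p q
    proof -
      have "r + E i x \<noteq> 0" for i x
        using rE[of i x] by linarith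
      then show ?thesis
        using that by (auto simp: M_def)
    qed
    show "d p s \<le> d p q + d q s" if pqs: "p \<in> M" "q \<in> M" "s \<in> M" for p q s
    proof -
      consider (SSS) i j k where "p = Inl i" "q = Inl j" "s = Inl k" "i \<in> mspace S" "j \<in> mspace S" "k \<in> mspace S"
        | (SSX) i j x where "p = Inl i" "q = Inl j" "s = Inr x" "i \<in> mspace S" "j \<in> mspace S" "x \<in> mspace X"
        | (SXS) i x j where "p = Inl i" "q = Inr x" "s = Inl j" "i \<in> mspace S" "x \<in> mspace X" "j \<in> mspace S"
        | (SXX) i x y where "p = Inl i" "q = Inr x" "s = Inr y" "i \<in> mspace S" "x \<in> mspace X" "y \<in> mspace X"
        | (XSS) x i j where "p = Inr x" "q = Inl i" "s = Inl j" "x \<in> mspace X" "i \<in> mspace S" "j \<in> mspace S"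
        | (XSX) x i y where "p = Inr x" "q = Inl i" "s = Inr y" "x \<in> mspace X" "i \<in> mspace S" "y \<in> mspace X"
        | (XXS) x y i where "p = Inr x" "q = Inr y" "s = Inl i" "x \<in> mspace X" "y \<in> mspace X" "i \<in> mspace S"
        | (XXX) x y z where "p = Inr x" "q = Inr y" "s = Inr z" "x \<in> mspace X" "y \<in> mspace X" "z \<in> mspace X"
        using pqs by (cases p; cases q; cases s) (simp_all add: mem_M)
      then show ?thesis
      proof cases
        case SSS then show ?thesis by (simp add: mdist_triangle)
      next
        case SSX then show ?thesis using E_S[of i j x] by simp
      next
        case SXS then show ?thesis using S_E[of i j x] by simp
      next
        case SXX then show ?thesis using E_X[of x y i] by simp
      next
        case XSS then show ?thesis using E_S[of j i x] by (simp add: mdist_commute)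
      next
        case XSX then show ?thesis using X_E[of i x y] by simp
      next
        case XXS then show ?thesis using E_X[of y x i] by (simp add: mdist_commute)
      next
        case XXX then show ?thesis by (simp add: mdist_triangle)
      qed
    qed
  qed
  then obtain Z where Z: "mspace Z = M" "mdist Z = d"
    by (metis Metric_space.mspace_metric Metric_space.mdist_metric)
  have subM: "Inl ` mspace S \<subseteq> mspace Z" "Inr ` mspace X \<subseteq> mspace Z"
    by (auto simp: Z M_def)
  have "isometric_metrics S (submetric Z (Inl ` mspace S))"
    unfolding isometric_metrics_def using subM(1)
    by (intro exI[of _ Inl]) (auto simp: Z(2) Int_absorb1 Int_absorb2 bij_betw_def)
  moreover have "isometric_metrics X (submetric Z (Inr ` mspace X))"
    unfolding isometric_metrics_def using subM(2)
    by (intro exI[of _ Inr]) (auto simp: Z(2) Int_absorb1 Int_absorb2 bij_betw_def)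
  moreover have "hausdorff_dist Z (Inl ` mspace S) (Inr ` mspace X) \<le> ereal r"
  proof -
    have bridge: "mdist Z (Inl (f x)) (Inr x) \<le> r" if "x \<in> mspace X" for x
      using E_le[OF that, of "f x" x] mdist_zero[OF fS[OF that] fS[OF that]] mdist_zero[OF that that]
      by (simp add: Z(2))
    have "(INF b\<in>Inr ` mspace X. ereal (mdist Z a b)) \<le> ereal r" if a: "a \<in> Inl ` mspace S" for a
    proof -
      obtain x where "x \<in> mspace X" "a = Inl (f x)"
        using a f by blast
      then show ?thesis
        using bridge by (intro INF_lower2[of "Inr x"]) simp_all
    qed
    moreover have "(INF a\<in>Inl ` mspace S. ereal (mdist Z a b)) \<le> ereal r" if b: "b \<in> Inr ` mspace X" for b
    proof -
      obtain x where "x \<in> mspace X" "b = Inr x"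
        using b by blast
      then show ?thesis
        using bridge fS by (intro INF_lower2[of "Inl (f x)"]) simp_all
    qed
    ultimately show ?thesis
      unfolding hausdorff_dist_def by (intro max.boundedI SUP_least)
  qed
  ultimately show ?thesis
    using gh_dist_le[OF subM] by blast
qed

section \<open>Distance to a simplex\<close>

lemma metric_simplex_mdist:
  assumes "metric_simplex l S" "i \<in> mspace S" "j \<in> mspace S"
  shows "mdist S i j = (if i = j then 0 else l)"
  using assms by (auto simp: metric_simplex_def)

lemma le_twice_gh_distI:
  assumes "\<And>t. gh_dist S X < ereal t \<Longrightarrow> c \<le> ereal (2 * t)"
  shows "c \<le> 2 * gh_dist S X"
proof (cases "gh_dist S X")
  case (real g)
  have "c \<le> ereal (2 * g) + ereal e" if "0 < e" for e
    using assms[of "g + e / 2"] that real by (simp add: algebra_simps)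
  then show ?thesis
    using real by (simp add: ereal_le_epsilon2)
next
  case PInf
  then show ?thesis by simp
next
  case MInf
  have "c \<le> ereal b" for b
    using assms[of "b / 2"] MInf by simp
  then show ?thesis
    using MInf by (simp add: ereal_bot)
qed

lemma diam_minus_le_twice_gh_dist_simplex:
  fixes S :: "'b metric" and X :: "'a metric"
  assumes "metric_simplex l S" "0 < l"
  shows "set_diam X (mspace X) - ereal l \<le> 2 * gh_dist S X"
proof (rule le_twice_gh_distI)
  fix t assume "gh_dist S X < ereal t"
  then obtain R where total: "\<And>x. x \<in> mspace X \<Longrightarrow> \<exists>i\<in>mspace S. R i x"
    and dis: "\<And>i j x y. \<lbrakk>i \<in> mspace S; j \<in> mspace S; x \<in> mspace X; y \<in> mspace X; R i x; R j y\<rbrakk>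
       \<Longrightarrow> \<bar>mdist S i j - mdist X x y\<bar> < 2 * t"
    by (rule gh_dist_less_imp_correspondence) blast
  have "ereal (mdist X x y) \<le> ereal (l + 2 * t)" if xy: "x \<in> mspace X" "y \<in> mspace X" for x y
  proof -
    obtain i j where "i \<in> mspace S" "j \<in> mspace S" "R i x" "R j y"
      using total xy by blast
    then show ?thesis
      using dis[of i j x y] xy metric_simplex_mdist[OF assms(1), of i j] \<open>0 < l\<close>
      by (auto split: if_splits)
  qed
  then have "set_diam X (mspace X) \<le> ereal (l + 2 * t)"
    unfolding set_diam_def by (intro SUP_least)
  then show "set_diam X (mspace X) - ereal l \<le> ereal (2 * t)"
    by (cases "set_diam X (mspace X)") auto
qed

text \<open>
  A correspondence of distortion less than \<open>l\<close> cannot relate a point of \<open>X\<close> to two points of the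
  simplex, so it is the graph of a surjection.
\<close>

lemma minus_alpha_le_twice_gh_dist_simplex:
  fixes S :: "'b metric" and X :: "'a metric"
  assumes simplex: "metric_simplex l S"
    and "mspace S \<noteq> {}" "|mspace S| \<le>o |mspace X|"
  shows "ereal l - alpha |mspace S| X \<le> 2 * gh_dist S X"
proof (rule le_twice_gh_distI)
  fix t assume "gh_dist S X < ereal t"
  then obtain R where totS: "\<And>i. i \<in> mspace S \<Longrightarrow> \<exists>x\<in>mspace X. R i x"
    and totX: "\<And>x. x \<in> mspace X \<Longrightarrow> \<exists>i\<in>mspace S. R i x"
    and dis: "\<And>i j x y. \<lbrakk>i \<in> mspace S; j \<in> mspace S; x \<in> mspace X; y \<in> mspace X; R i x; R j y\<rbrakk>
       \<Longrightarrow> \<bar>mdist S i j - mdist X x y\<bar> < 2 * t"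
    by (rule gh_dist_less_imp_correspondence) blast
  have "ereal (l - 2 * t) \<le> alpha |mspace S| X"
  proof (cases "2 * t \<le> l")
    case False
    then show ?thesis
      using alpha_nonneg[OF assms(2,3)] by (simp add: order_trans[of _ 0])
  next
    case True
    obtain f where f: "\<And>x. x \<in> mspace X \<Longrightarrow> f x \<in> mspace S \<and> R (f x) x"
      using totX by metis
    have unique: "f x = i" if "i \<in> mspace S" "x \<in> mspace X" "R i x" for i x
    proof (rule ccontr)
      assume "f x \<noteq> i"
      then have "mdist S (f x) i = l"
        using f[OF that(2)] that(1) metric_simplex_mdist[OF simplex] by simp
      moreover have "\<bar>mdist S (f x) i - mdist X x x\<bar> < 2 * t"
        using dis f[OF that(2)] that by blast
      moreover have "mdist X x x = 0"
        using mdist_zero[OF that(2,2)] by simp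
      ultimately show False
        using True by linarith
    qed
    have surj: "f ` mspace X = mspace S"
      using f totS unique by blast
    have "ereal (l - 2 * t) \<le> ereal (mdist X x y)"
      if "x \<in> mspace X" "y \<in> mspace X" "f x \<noteq> f y" for x y
      using dis[of "f x" "f y" x y] f that metric_simplex_mdist[OF simplex, of "f x" "f y"] by auto
    then have "ereal (l - 2 * t) \<le> part_alpha X (fibres f (mspace X))"
      by (simp add: le_part_alpha_fibres_iff)
    also have "\<dots> \<le> alpha |mspace S| X"
      unfolding alpha_def using surj by (intro SUP_upper) (auto simp: card_partitions_eq_fibres)
    finally show ?thesis .
  qed
  then show "ereal l - alpha |mspace S| X \<le> ereal (2 * t)"
    by (cases "alpha |mspace S| X") auto
qed

text \<open>
  The surjection sending each block to its own point of the simplex has distortion at most \<open>c\<close>: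
  distances within a block are compared with \<open>0\<close>, those between distinct blocks with \<open>l\<close>.
\<close>

lemma twice_gh_dist_simplex_le:
  fixes S :: "'b metric" and X :: "'a metric"
  assumes simplex: "metric_simplex l S" and ne: "mspace X \<noteq> {}"
    and D: "D \<in> card_partitions |mspace S| X" and "0 < c"
    and diam_D: "part_diam X D \<le> ereal c"
    and diam_X: "set_diam X (mspace X) - ereal l \<le> ereal c"
    and alpha_D: "ereal l - part_alpha X D \<le> ereal c"
  shows "2 * gh_dist S X \<le> ereal c"
proof -
  obtain f where f: "f ` mspace X = mspace S" and Df: "D = fibres f (mspace X)"
    using D unfolding card_partitions_eq_fibres by blast
  have "ereal (l - c) \<le> part_alpha X D"
    using alpha_D by (cases "part_alpha X D") auto
  then have far: "l - c \<le> mdist X x y" if "x \<in> mspace X" "y \<in> mspace X" "f x \<noteq> f y" for x y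
    using that by (auto simp: Df le_part_alpha_fibres_iff)
  have "set_diam X (mspace X) \<le> ereal (l + c)"
    using diam_X by (cases "set_diam X (mspace X)") auto
  then have bounded: "mdist X x y \<le> l + c" if "x \<in> mspace X" "y \<in> mspace X" for x y
    using mdist_le_set_diam[OF that, of X] by (meson ereal_less_eq(3) order_trans)
  have near: "mdist X x y \<le> c" if "x \<in> mspace X" "y \<in> mspace X" "f x = f y" for x y
    using mdist_le_part_diam_fibres[OF that] diam_D Df by (metis ereal_less_eq(3) order_trans)
  have "gh_dist S X \<le> ereal (c / 2)"
  proof (rule gh_dist_le_of_surjection[OF f ne])
    fix x y assume xy: "x \<in> mspace X" "y \<in> mspace X"
    then have "mdist S (f x) (f y) = (if f x = f y then 0 else l)"
      using f by (intro metric_simplex_mdist[OF simplex]) auto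
    then show "\<bar>mdist S (f x) (f y) - mdist X x y\<bar> \<le> 2 * (c / 2)"
      using near[OF xy] far[OF xy] bounded[OF xy] by (auto split: if_splits)
  qed (use \<open>0 < c\<close> in simp)
  then show ?thesis
    by (cases "gh_dist S X") auto
qed

lemma set_diam_finite:
  assumes "Metric_space.mbounded (mspace X) (mdist X) (mspace X)" "mspace X \<noteq> {}"
  obtains d where "set_diam X (mspace X) = ereal d"
proof -
  obtain B where "\<And>x y. x \<in> mspace X \<Longrightarrow> y \<in> mspace X \<Longrightarrow> mdist X x y \<le> B"
    using assms(1) by (auto simp: Metric_space.mbounded_alt[OF Metric_space_mspace_mdist])
  then have "set_diam X (mspace X) \<le> ereal B"
    unfolding set_diam_def by (intro SUP_least) auto
  moreover obtain x where "x \<in> mspace X"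
    using assms(2) by blast
  then have "ereal (mdist X x x) \<le> set_diam X (mspace X)"
    by (intro mdist_le_set_diam)
  ultimately show ?thesis
    using that by (cases "set_diam X (mspace X)") auto
qed

theorem corollary2p20:
  fixes X :: "'a metric" and S :: "'b metric" and l :: real and m :: "'b rel"
  assumes "mspace X \<noteq> {}" and "mspace S \<noteq> {}"
    and "Metric_space.mbounded (mspace X) (mdist X) (mspace X)"
    and "0 < l" and "metric_simplex l S"
    and "m = |mspace S|" and "m \<le>o |mspace X|"
    and "2 * d_plus m X \<le> set_diam X (mspace X) - alpha m X"
  shows "2 * gh_dist S X = max (set_diam X (mspace X) - ereal l) (ereal l - alpha m X)"
proof (rule antisym)
  have card: "|mspace S| \<le>o |mspace X|"
    using assms(6,7) by simp
  show "max (set_diam X (mspace X) - ereal l) (ereal l - alpha m X) \<le> 2 * gh_dist S X"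
    using diam_minus_le_twice_gh_dist_simplex[OF assms(5,4)]
      minus_alpha_le_twice_gh_dist_simplex[OF assms(5,2) card] assms(6) by simp
  obtain \<delta> where \<delta>: "set_diam X (mspace X) = ereal \<delta>"
    using set_diam_finite[OF assms(3,1)] .
  obtain D where D: "D \<in> card_partitions m X"
    using card_partitions_nonempty[OF assms(2) card] assms(6) by auto
  then have "0 \<le> part_diam X D"
    using part_diam_nonneg assms(1,6) by metis
  also have "part_diam X D \<le> d_plus m X"
    unfolding d_plus_def using D by (rule SUP_upper)
  finally have dpos: "0 \<le> d_plus m X" .
  \<comment> \<open>An infinite \<open>alpha m X\<close>, as for a one-point simplex, would make the right-hand side of the
    hypothesis \<open>-\<infinity>\<close>.\<close>
  obtain a where a: "alpha m X = ereal a"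
    using alpha_nonneg[OF assms(2) card] assms(6,8) \<delta> dpos
    by (cases "alpha m X"; cases "d_plus m X") auto
  obtain p where p: "d_plus m X = ereal p"
    using assms(8) \<delta> a dpos by (cases "d_plus m X") auto
  have "2 * p \<le> \<delta> - a"
    using assms(8) by (simp add: \<delta> a p)
  then have p_le: "p \<le> max (\<delta> - l) (l - a)"
    by linarith
  \<comment> \<open>The supremum \<open>alpha m X\<close> need not be attained, so the bound is approached from above, with a
    partition chosen for each \<open>c\<close>.\<close>
  have bound: "2 * gh_dist S X \<le> ereal c" if c: "max (\<delta> - l) (l - a) < c" for c
  proof -
    have "ereal (l - c) < alpha m X"
      using c a by simp
    then obtain D where D: "D \<in> card_partitions m X" and alpha_D: "ereal (l - c) < part_alpha X D"
      unfolding alpha_def less_SUP_iff by blast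
    show ?thesis
    proof (rule twice_gh_dist_simplex_le[OF assms(5,1)])
      show "D \<in> card_partitions |mspace S| X"
        using D assms(6) by simp
      show "0 < c"
        using dpos[unfolded p] p_le c by (simp only: ereal_less_eq)
      have "part_diam X D \<le> d_plus m X"
        unfolding d_plus_def using D by (rule SUP_upper)
      also have "\<dots> \<le> ereal c"
        unfolding p ereal_less_eq using p_le c by linarith
      finally show "part_diam X D \<le> ereal c" .
      show "set_diam X (mspace X) - ereal l \<le> ereal c"
        using c \<delta> by simp
      show "ereal l - part_alpha X D \<le> ereal c"
        using alpha_D by (cases "part_alpha X D") auto
    qed
  qed
  have "2 * gh_dist S X \<le> ereal (max (\<delta> - l) (l - a)) + ereal e" if "0 < e" for e
    unfolding plus_ereal.simps using that by (intro bound) linarith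
  then have "2 * gh_dist S X \<le> ereal (max (\<delta> - l) (l - a))"
    by (rule ereal_le_epsilon2)
  also have "\<dots> = max (set_diam X (mspace X) - ereal l) (ereal l - alpha m X)"
    unfolding \<delta> a by simp
  finally show "2 * gh_dist S X \<le> max (set_diam X (mspace X) - ereal l) (ereal l - alpha m X)" .
qed

end
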